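(* Let $H$ be a separable complex Hilbert space and let $T$ be a densely defined closed symmetric operator in $H$ with equal deficiency indices, i.e. $\dim\ker(T^*-\mathfrak{i})=\dim\ker(T^*+\mathfrak{i})\in\mathbb{N}\cup\{\infty\}$. Then $T$ has a self-adjoint extension with compact resolvent if and only if the domain $D(T)$, equipped with its graph norm, is compactly embedded in $H$.
   Context: $\mathfrak{i}$ is the imaginary unit. The graph norm on $D(T)$ is $\|x\|_g=(\|x\|_H^2+\|Tx\|_H^2)^{1/2}$; "compactly embedded" means the inclusion map $(D(T),\|\cdot\|_g)\to H$ is a compact operator. A self-adjoint extension of $T$ is a self-adjoint operator $\tilde T$ in $H$ with $T\subseteq\tilde T\subseteq T^*$. It has compact resolvent if $(\tilde T-\mathfrak{i})^{-1}$ is a compact operator on $H$ (equivalently $(\tilde T-\lambda)^{-1}$ is compact for every $\lambda$ in the resolvent set $\rho(\tilde T)$). *)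

theory Defs
  imports "HOL-Analysis.Analysis"
begin

section \<open>Complex Hilbert spaces\<close>

text \<open>
  The real inner product of the superclass is the real part of the complex one, so the norm,
  metric and topology inherited from \<^class>\<open>real_inner\<close> are those of the complex inner product
  (see \<open>cinner_self\<close> below). The complex inner product is linear in its first argument.
\<close>

class complex_inner = real_inner +
  fixes scaleC :: "complex \<Rightarrow> 'a \<Rightarrow> 'a" (infixr \<open>*\<^sub>C\<close> 75)
    and cinner :: "'a \<Rightarrow> 'a \<Rightarrow> complex"
  assumes scaleC_add_right: "c *\<^sub>C (x + y) = c *\<^sub>C x + c *\<^sub>C y"
    and scaleC_add_left: "(c + d) *\<^sub>C x = c *\<^sub>C x + d *\<^sub>C x"
    and scaleC_scaleC: "c *\<^sub>C (d *\<^sub>C x) = (c * d) *\<^sub>C x"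
    and scaleC_of_real: "complex_of_real r *\<^sub>C x = r *\<^sub>R x"
    and cinner_commute: "cinner x y = cnj (cinner y x)"
    and cinner_add_left: "cinner (x + y) z = cinner x z + cinner y z"
    and cinner_scaleC_left: "cinner (c *\<^sub>C x) y = c * cinner x y"
    and inner_eq_Re_cinner: "inner x y = Re (cinner x y)"

class complex_hilbert = complex_inner + complete_space

lemma cinner_self: "cinner x x = complex_of_real ((norm x)\<^sup>2)"
proof -
  have "Im (cinner x x) = 0"
    using arg_cong[OF cinner_commute[of x x], of Im] by simp
  then show ?thesis
    by (simp add: complex_eq_iff power2_norm_eq_inner inner_eq_Re_cinner)
qed

instantiation complex :: complex_hilbert
begin

definition scaleC_complex :: "complex \<Rightarrow> complex \<Rightarrow> complex"
  where "scaleC_complex c x = c * x"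

definition cinner_complex :: "complex \<Rightarrow> complex \<Rightarrow> complex"
  where "cinner_complex x y = x * cnj y"

instance
  by standard
    (simp_all add: scaleC_complex_def cinner_complex_def inner_complex_def scaleR_conv_of_real
      algebra_simps)

end

global_interpretation complex_vector:
  vector_space "scaleC :: complex \<Rightarrow> 'a \<Rightarrow> 'a::complex_inner"
proof unfold_locales
  show "1 *\<^sub>C x = x" for x :: 'a
    using scaleC_of_real[of 1 x] by simp
qed (simp_all add: scaleC_add_right scaleC_add_left scaleC_scaleC)

text \<open>
  The dimension of a complex subspace with values in \<open>\<nat> \<union> {\<infinity>}\<close>. The library's
  \<^const>\<open>complex_vector.dim\<close> is a natural number, equal to 0 on
  infinite-dimensional spaces.
\<close>

definition cdim :: "'a::complex_inner set \<Rightarrow> enat" where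
  "cdim V = (if \<exists>B. finite B \<and> V \<subseteq> complex_vector.span B
             then enat (complex_vector.dim V) else \<infinity>)"

definition clinear_on :: "'a::complex_inner set \<Rightarrow> ('a \<Rightarrow> 'b::complex_inner) \<Rightarrow> bool" where
  "clinear_on D f \<longleftrightarrow> complex_vector.subspace D \<and>
     (\<forall>x\<in>D. \<forall>y\<in>D. f (x + y) = f x + f y) \<and>
     (\<forall>c. \<forall>x\<in>D. f (c *\<^sub>C x) = c *\<^sub>C f x)"

text \<open>
  \<open>f\<close> is a compact operator from the space \<open>D\<close>, normed by \<open>n\<close>, into a complex Hilbert space:
  the image of the unit ball is relatively compact.
\<close>

definition compact_linear_on ::
  "'a::complex_inner set \<Rightarrow> ('a \<Rightarrow> real) \<Rightarrow> ('a \<Rightarrow> 'b::complex_inner) \<Rightarrow> bool" where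
  "compact_linear_on D n f \<longleftrightarrow> clinear_on D f \<and> compact (closure (f ` {x \<in> D. n x \<le> 1}))"

section \<open>Unbounded operators\<close>

text \<open>
  An operator in \<open>H\<close> is a partial map \<open>T\<close> on \<open>H\<close>, with domain \<^term>\<open>dom T\<close> and value
  \<^term>\<open>the (T x)\<close> at \<open>x\<close> in the domain. Then \<open>S\<close> extends \<open>T\<close> iff \<^term>\<open>T \<subseteq>\<^sub>m S\<close>, and equality of
  operators includes equality of their domains.
\<close>

definition linear_operator :: "('a::complex_inner \<rightharpoonup> 'a) \<Rightarrow> bool" where
  "linear_operator T \<longleftrightarrow> clinear_on (dom T) (\<lambda>x. the (T x))"

definition densely_defined :: "('a::complex_inner \<rightharpoonup> 'a) \<Rightarrow> bool" where
  "densely_defined T \<longleftrightarrow> closure (dom T) = UNIV"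

definition closed_operator :: "('a::complex_inner \<rightharpoonup> 'a) \<Rightarrow> bool" where
  "closed_operator T \<longleftrightarrow> closed (Map.graph T)"

definition symmetric_operator :: "('a::complex_inner \<rightharpoonup> 'a) \<Rightarrow> bool" where
  "symmetric_operator T \<longleftrightarrow>
     (\<forall>x\<in>dom T. \<forall>y\<in>dom T. cinner (the (T x)) y = cinner x (the (T y)))"

text \<open>The vector \<open>z\<close> below is unique, and the definition is meaningful, for densely defined \<open>T\<close>.\<close>

definition adjoint_operator :: "('a::complex_inner \<rightharpoonup> 'a) \<Rightarrow> ('a \<rightharpoonup> 'a)" where
  "adjoint_operator T = (\<lambda>y.
     if \<exists>z. \<forall>x\<in>dom T. cinner (the (T x)) y = cinner x z
     then Some (THE z. \<forall>x\<in>dom T. cinner (the (T x)) y = cinner x z)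
     else None)"

definition self_adjoint :: "('a::complex_inner \<rightharpoonup> 'a) \<Rightarrow> bool" where
  "self_adjoint T \<longleftrightarrow> linear_operator T \<and> densely_defined T \<and> adjoint_operator T = T"

definition self_adjoint_extension ::
  "('a::complex_inner \<rightharpoonup> 'a) \<Rightarrow> ('a \<rightharpoonup> 'a) \<Rightarrow> bool" where
  "self_adjoint_extension T S \<longleftrightarrow>
     self_adjoint S \<and> T \<subseteq>\<^sub>m S \<and> S \<subseteq>\<^sub>m adjoint_operator T"

text \<open>The operator \<open>T - c\<close> with the same domain as \<open>T\<close>.\<close>

definition minus_scalar :: "('a::complex_inner \<rightharpoonup> 'a) \<Rightarrow> complex \<Rightarrow> ('a \<rightharpoonup> 'a)" where
  "minus_scalar T c = (\<lambda>x. map_option (\<lambda>y. y - c *\<^sub>C x) (T x))"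

definition operator_kernel :: "('a::complex_inner \<rightharpoonup> 'a) \<Rightarrow> 'a set" where
  "operator_kernel T = {x \<in> dom T. the (T x) = 0}"

text \<open>The inverse of \<open>T - c\<close>, meaningful if \<open>T - c\<close> is a bijection from its domain onto the space.\<close>

definition resolvent :: "('a::complex_inner \<rightharpoonup> 'a) \<Rightarrow> complex \<Rightarrow> 'a \<Rightarrow> 'a" where
  "resolvent T c = the_inv_into (dom T) (\<lambda>x. the (minus_scalar T c x))"

definition compact_resolvent :: "('a::complex_inner \<rightharpoonup> 'a) \<Rightarrow> bool" where
  "compact_resolvent T \<longleftrightarrow>
     bij_betw (\<lambda>x. the (minus_scalar T \<i> x)) (dom T) UNIV \<and>
     compact_linear_on UNIV norm (resolvent T \<i>)"

definition graph_norm :: "('a::complex_inner \<rightharpoonup> 'a) \<Rightarrow> 'a \<Rightarrow> real" where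
  "graph_norm T x = sqrt ((norm x)\<^sup>2 + (norm (the (T x)))\<^sup>2)"

definition domain_compactly_embedded :: "('a::complex_inner \<rightharpoonup> 'a) \<Rightarrow> bool" where
  "domain_compactly_embedded T \<longleftrightarrow> compact_linear_on (dom T) (graph_norm T) (\<lambda>x. x)"

end

theory Submission
  imports Defs
begin

text \<open>
  If \<open>S\<close> is a self-adjoint extension of \<open>T\<close>, then \<open>\<parallel>(S - \<i>) x\<parallel>\<^sup>2 = \<parallel>S x\<parallel>\<^sup>2 + \<parallel>x\<parallel>\<^sup>2\<close>, so the resolvent of \<open>S\<close>
  maps the unit ball onto a set containing the unit ball of \<open>D(T)\<close> for the graph norm.

  Conversely, a compact embedding leaves some real \<open>r\<close> that is not an eigenvalue of \<open>T\<close> and makes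
  \<open>T - r\<close> bounded below with closed range \<open>M\<close>. With the orthogonal projection \<open>P\<close> onto \<open>M\<close>, the operator
  \<open>C = (T - r)\<^sup>-\<^sup>1 P\<close> is compact, and \<open>B = C + C\<^sup>* (1 - P)\<close> is a compact symmetric operator on the whole
  space that extends \<open>(T - r)\<^sup>-\<^sup>1\<close>. Its range contains the dense set \<open>D(T)\<close>, so \<open>B\<close> is injective, and
  \<open>B\<^sup>-\<^sup>1 + r\<close> is the required extension.

  Orthogonality and adjoints are treated with the real inner product; for complex linear maps and
  complex subspaces this amounts to the same.
\<close>

section \<open>Orthogonal projections and adjoints in Hilbert spaces\<close>

text \<open>A minimising sequence for the distance from \<open>x\<close> to \<open>M\<close> is
  Cauchy by the parallelogram law. Its limit is a nearest point, and varying that point inside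
  \<open>M\<close> gives orthogonality.\<close>

lemma orthogonal_projection_exists:
  fixes M :: "'a::{real_inner,complete_space} set"
  assumes M: "subspace M" "closed M"
  shows "\<exists>p\<in>M. \<forall>m\<in>M. inner (x - p) m = 0"
proof -
  define d where "d = infdist x M"
  have ne: "M \<noteq> {}"
    using M(1) subspace_0 by auto
  have d0: "d \<ge> 0" and d_le: "d \<le> norm (x - m)" if "m \<in> M" for m
    using infdist_le[OF that, of x] by (auto simp: d_def infdist_nonneg dist_norm)
  have d2_le: "d\<^sup>2 \<le> (norm (x - m))\<^sup>2" if "m \<in> M" for m
    using d_le[OF that] d0[OF that] by (simp add: power_mono)
  have "\<exists>m\<in>M. (norm (x - m))\<^sup>2 < d\<^sup>2 + inverse (Suc n)" for n
  proof -
    have "d < sqrt (d\<^sup>2 + inverse (Suc n))"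
      by (rule real_less_rsqrt) simp
    then obtain m where "m \<in> M" "dist x m < sqrt (d\<^sup>2 + inverse (Suc n))"
      using cInf_lessD[of "dist x ` M"] ne by (auto simp: d_def infdist_notempty)
    moreover from this have "(norm (x - m))\<^sup>2 < (sqrt (d\<^sup>2 + inverse (Suc n)))\<^sup>2"
      by (intro power_strict_mono) (auto simp: dist_norm)
    ultimately show ?thesis by auto
  qed
  then obtain m where mM: "m n \<in> M" and m: "(norm (x - m n))\<^sup>2 < d\<^sup>2 + inverse (Suc n)" for n
    by metis
  have close: "(norm (m i - m j))\<^sup>2 \<le> 2 * inverse (Suc i) + 2 * inverse (Suc j)" for i j
  proof -
    \<comment> \<open>The midpoint lies in \<open>M\<close>, so its distance to \<open>x\<close> is
      at least \<open>d\<close>. The parallelogram law turns this into an upper bound for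
      \<open>norm (m i - m j)\<close>.\<close>
    have "(1/2) *\<^sub>R (m i + m j) \<in> M"
      using M(1) mM by (simp add: subspace_add subspace_scale)
    from d2_le[OF this] have "4 * d\<^sup>2 \<le> (norm (2 *\<^sub>R (x - (1/2) *\<^sub>R (m i + m j))))\<^sup>2"
      by (simp add: power_mult_distrib del: scaleR_right_diff_distrib)
    also have "2 *\<^sub>R (x - (1/2) *\<^sub>R (m i + m j)) = (x - m i) + (x - m j)"
      by (simp add: algebra_simps scaleR_2)
    also have "(norm \<dots>)\<^sup>2 = 2 * (norm (x - m i))\<^sup>2 + 2 * (norm (x - m j))\<^sup>2 - (norm (m i - m j))\<^sup>2"
      by (simp add: power2_norm_eq_inner algebra_simps inner_commute)
    finally show ?thesis
      using m[of i] m[of j] by linarith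
  qed
  have "Cauchy m"
  proof (rule metric_CauchyI)
    fix e :: real assume e: "e > 0"
    then obtain N where N: "inverse (real (Suc N)) < e\<^sup>2 / 4"
      using reals_Archimedean[of "e\<^sup>2 / 4"] by auto
    have "dist (m i) (m j) < e" if "i \<ge> N" "j \<ge> N" for i j
    proof -
      have "inverse (real (Suc k)) \<le> inverse (real (Suc N))" if "k \<ge> N" for k
        using that by simp
      from this[OF that(1)] this[OF that(2)] have "(norm (m i - m j))\<^sup>2 < e\<^sup>2"
        using close[of i j] N by linarith
      then show ?thesis
        using e by (simp add: dist_norm power_less_imp_less_base)
    qed
    then show "\<exists>N. \<forall>i\<ge>N. \<forall>j\<ge>N. dist (m i) (m j) < e" by blast
  qed
  then obtain p where p: "m \<longlonglongrightarrow> p"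
    by (auto simp: Cauchy_convergent_iff convergent_def)
  have pM: "p \<in> M"
    using closed_sequentially[OF M(2)] mM p by blast
  have "(norm (x - p))\<^sup>2 \<le> d\<^sup>2"
  proof (rule tendsto_le)
    show "(\<lambda>n. (norm (x - m n))\<^sup>2) \<longlonglongrightarrow> (norm (x - p))\<^sup>2"
      by (intro tendsto_intros p)
    show "(\<lambda>n. d\<^sup>2 + inverse (Suc n)) \<longlonglongrightarrow> d\<^sup>2"
      using tendsto_add[OF tendsto_const LIMSEQ_inverse_real_of_nat, of "d\<^sup>2"] by simp
  qed (use m in \<open>auto simp: less_imp_le\<close>)
  have "inner (x - p) n = 0" if n: "n \<in> M" for n
  proof (cases "n = 0")
    case False
    \<comment> \<open>\<open>t\<close> is the coefficient minimising the norm of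
      \<open>x - p - t n\<close>. Since \<open>p\<close> is already nearest, moving by
      \<open>t n\<close> gains nothing, which forces \<open>t = 0\<close>.\<close>
    define t where "t = inner (x - p) n / (norm n)\<^sup>2"
    have t: "t * (norm n)\<^sup>2 = inner (x - p) n"
      using False by (simp add: t_def)
    have "p + t *\<^sub>R n \<in> M"
      using M(1) pM n by (simp add: subspace_add subspace_scale)
    from order_trans[OF \<open>(norm (x - p))\<^sup>2 \<le> d\<^sup>2\<close> d2_le[OF this]]
    have "(norm (x - p))\<^sup>2 \<le> (norm (x - (p + t *\<^sub>R n)))\<^sup>2" .
    also have "\<dots> = (norm ((x - p) - t *\<^sub>R n))\<^sup>2"
      by (simp add: algebra_simps)
    also have "\<dots> = (norm (x - p))\<^sup>2 - 2 * t * inner (x - p) n + t * t * (norm n)\<^sup>2"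
      unfolding power2_norm_eq_inner inner_diff_left[of "x - p"] inner_diff_right[of _ "x - p"]
      by (simp add: inner_commute[of n "x - p"])
    also have "t * t * (norm n)\<^sup>2 = t * inner (x - p) n"
      using t by (simp only: mult.assoc)
    finally have "t * (t * (norm n)\<^sup>2) \<le> 0"
      unfolding t by linarith
    then have "t\<^sup>2 * (norm n)\<^sup>2 \<le> 0"
      by (simp only: power2_eq_square mult.assoc)
    then have "t = 0"
      using False by (simp add: mult_le_0_iff)
    with t show ?thesis by simp
  qed simp
  with pM show ?thesis by blast
qed

text \<open>If \<open>f\<close> is not zero, its kernel has a one-dimensional orthogonal complement.
  The component \<open>w\<close> of a vector outside the kernel spans it, and a multiple of
  \<open>w\<close> represents \<open>f\<close>.\<close>

lemma riesz_representation:
  fixes f :: "'a::{real_inner,complete_space} \<Rightarrow> real"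
  assumes f: "bounded_linear f"
  shows "\<exists>z. \<forall>x. f x = inner x z"
proof (cases "\<forall>x. f x = 0")
  case True
  then show ?thesis by (intro exI[of _ 0]) simp
next
  case False
  then obtain x where x: "f x \<noteq> 0" by blast
  interpret f: bounded_linear f by fact
  have "subspace {x. f x = 0}"
    by (simp add: subspace_def f.add f.scaleR)
  moreover have "closed {x. f x = 0}"
    by (intro closed_Collect_eq f.continuous_on continuous_intros)
  ultimately obtain p where p: "f p = 0" "\<And>m. f m = 0 \<Longrightarrow> inner (x - p) m = 0"
    using orthogonal_projection_exists[of "{x. f x = 0}" x] by auto
  define w where "w = x - p"
  have fw: "f w \<noteq> 0"
    using x p by (simp add: w_def f.diff)
  then have w0: "inner w w \<noteq> 0" by (metis f.zero inner_eq_zero_iff)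
  have "f y = inner y ((f w / inner w w) *\<^sub>R w)" for y
  proof -
    have "f (y - (f y / f w) *\<^sub>R w) = 0"
      using fw by (simp add: f.diff f.scaleR)
    then have "inner w (y - (f y / f w) *\<^sub>R w) = 0"
      using p(2) by (simp add: w_def)
    then show ?thesis
      using fw w0 by (simp add: inner_diff_right inner_commute field_simps)
  qed
  then show ?thesis by blast
qed

section \<open>Adjoints of bounded operators\<close>

text \<open>\<open>adjoint\<close> is defined by choice, so its defining property holds as soon as
  some adjoint exists. The Riesz representation supplies one value for each
  \<open>y\<close>.\<close>

lemma adjoint_works_bounded_linear:
  fixes f :: "'a::{real_inner,complete_space} \<Rightarrow> 'b::real_inner"
  assumes f: "bounded_linear f"
  shows "inner x (adjoint f y) = inner (f x) y"
proof -
  interpret f: bounded_linear f by fact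
  have "\<exists>z. \<forall>x. inner (f x) y = inner x z" for y
    by (intro riesz_representation bounded_linear_inner_left_comp f)
  then have "\<exists>f'. \<forall>x y. inner (f x) y = inner x (f' y)"
    by metis
  then have "\<forall>x y. inner (f x) y = inner x (adjoint f y)"
    unfolding adjoint_def by (rule someI_ex)
  then show ?thesis by simp
qed

lemma bounded_linear_adjoint:
  fixes f :: "'a::{real_inner,complete_space} \<Rightarrow> 'b::real_inner"
  assumes f: "bounded_linear f"
  shows "bounded_linear (adjoint f)"
proof -
  interpret f: bounded_linear f by fact
  note adj = adjoint_works_bounded_linear[OF f]
  obtain K where K0: "K \<ge> 0" and K: "\<And>x. norm (f x) \<le> norm x * K"
    using f.nonneg_bounded by blast
  show ?thesis
  proof (rule bounded_linear_intro)
    show "adjoint f (x + y) = adjoint f x + adjoint f y" for x y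
      by (rule vector_eq_ldot[THEN iffD1]) (simp add: adj inner_add_right)
    show "adjoint f (c *\<^sub>R x) = c *\<^sub>R adjoint f x" for c x
      by (rule vector_eq_ldot[THEN iffD1]) (simp add: adj)
    show "norm (adjoint f y) \<le> norm y * K" for y
    \<comment> \<open>The estimate bounds the square of \<open>norm (adjoint f y)\<close>; one
      factor is cancelled, so the zero case is separate.\<close>
    proof (cases "adjoint f y = 0")
      case True
      with K0 show ?thesis by simp
    next
      case False
      have "norm (adjoint f y) * norm (adjoint f y) = inner (f (adjoint f y)) y"
        by (metis adj power2_eq_square power2_norm_eq_inner)
      also have "\<dots> \<le> norm (f (adjoint f y)) * norm y"
        by (rule norm_cauchy_schwarz)
      also have "\<dots> \<le> norm (adjoint f y) * K * norm y"
        by (intro mult_right_mono K) simp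
      finally show ?thesis
        using False by (simp add: mult.commute)
    qed
  qed
qed

section \<open>The orthogonal projection as a bounded linear map\<close>

text \<open>The choice is total; it yields the orthogonal projection when \<open>M\<close> is a
  closed subspace of a complete space.\<close>

definition orthogonal_projection :: "'a::real_inner set \<Rightarrow> 'a \<Rightarrow> 'a" where
  "orthogonal_projection M x = (SOME p. p \<in> M \<and> (\<forall>m\<in>M. inner (x - p) m = 0))"

context
  fixes M :: "'a::{real_inner,complete_space} set"
  assumes M: "subspace M" "closed M"
begin

lemma orthogonal_projection_mem: "orthogonal_projection M x \<in> M"
  and orthogonal_projection_orthogonal:
    "m \<in> M \<Longrightarrow> inner (x - orthogonal_projection M x) m = 0"
  using someI_ex[OF orthogonal_projection_exists[OF M, of x, unfolded Bex_def]]
  unfolding orthogonal_projection_def by blast+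

text \<open>The difference of two candidates lies in \<open>M\<close> and is orthogonal to
  \<open>M\<close>, hence to itself. Linearity and complex homogeneity of the projection are derived
  from this.\<close>

lemma orthogonal_projection_unique:
  assumes p: "p \<in> M" "\<And>m. m \<in> M \<Longrightarrow> inner (x - p) m = 0"
  shows "orthogonal_projection M x = p"
proof -
  let ?q = "orthogonal_projection M x"
  have "?q - p \<in> M"
    using M(1) p(1) orthogonal_projection_mem by (simp add: subspace_diff)
  then have "inner (x - p) (?q - p) - inner (x - ?q) (?q - p) = 0"
    using p(2) orthogonal_projection_orthogonal by simp
  then have "inner (?q - p) (?q - p) = 0"
    by (simp add: inner_diff_left[symmetric])
  then show ?thesis by simp
qed

lemma orthogonal_projection_ident: "x \<in> M \<Longrightarrow> orthogonal_projection M x = x"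
  by (rule orthogonal_projection_unique) simp_all

lemma norm_orthogonal_projection_le: "norm (orthogonal_projection M x) \<le> norm x"
proof -
  let ?q = "orthogonal_projection M x"
  have "inner (x - ?q) ?q = 0"
    by (intro orthogonal_projection_orthogonal orthogonal_projection_mem)
  then have "norm ?q * norm ?q = inner x ?q"
    by (simp add: inner_diff_left power2_eq_square[symmetric] power2_norm_eq_inner)
  also have "\<dots> \<le> norm x * norm ?q" by (rule norm_cauchy_schwarz)
  finally show ?thesis by (cases "?q = 0") auto
qed

lemma bounded_linear_orthogonal_projection: "bounded_linear (orthogonal_projection M)"
proof (rule bounded_linear_intro[where K = 1])
  note mem = orthogonal_projection_mem and orth = orthogonal_projection_orthogonal
  show "orthogonal_projection M (x + y) = orthogonal_projection M x + orthogonal_projection M y"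
    for x y
  proof (rule orthogonal_projection_unique)
    show "inner (x + y - (orthogonal_projection M x + orthogonal_projection M y)) m = 0"
      if "m \<in> M" for m
      using orth[OF that, of x] orth[OF that, of y] by (simp add: inner_simps)
  qed (simp add: subspace_add M mem)
  show "orthogonal_projection M (r *\<^sub>R x) = r *\<^sub>R orthogonal_projection M x" for r x
    by (rule orthogonal_projection_unique)
      (simp_all add: subspace_scale M mem orth scaleR_right_diff_distrib[symmetric])
  show "norm (orthogonal_projection M x) \<le> norm x * 1" for x
    using norm_orthogonal_projection_le by simp
qed

end

lemma inner_eq_on_dense_imp_eq:
  fixes z :: "'a::real_inner"
  assumes D: "closure D = UNIV" and eq: "\<And>x. x \<in> D \<Longrightarrow> inner x z = inner x z'"
  shows "z = z'"
proof -
  have "closed {x. inner x z = inner x z'}"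
    by (intro closed_Collect_eq continuous_intros)
  then have "closure D \<subseteq> {x. inner x z = inner x z'}"
    by (intro closure_minimal) (use eq in auto)
  then have "\<forall>x. inner x z = inner x z'"
    using D by auto
  then show ?thesis
    by (simp only: vector_eq_ldot)
qed

section \<open>Complex scalars and the real inner product\<close>

lemma inner_scaleC_left: "inner (c *\<^sub>C x) y = inner x (cnj c *\<^sub>C y)"
proof -
  have "cinner (c *\<^sub>C x) y = cinner x (cnj c *\<^sub>C y)"
    by (metis cinner_commute cinner_scaleC_left complex_cnj_cnj complex_cnj_mult)
  then show ?thesis by (simp add: inner_eq_Re_cinner)
qed

lemma norm_scaleC: "norm (c *\<^sub>C x) = cmod c * norm x"
proof (rule power2_eq_imp_eq)
  show "(norm (c *\<^sub>C x))\<^sup>2 = (cmod c * norm x)\<^sup>2"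
  proof -
    have "cnj c * c = of_real ((cmod c)\<^sup>2)"
      by (metis complex_norm_square mult.commute)
    then have "inner (c *\<^sub>C x) (c *\<^sub>C x) = (cmod c)\<^sup>2 * inner x x"
      by (simp only: inner_scaleC_left scaleC_scaleC scaleC_of_real inner_scaleR_right)
    then show ?thesis
      by (simp only: power2_norm_eq_inner power_mult_distrib)
  qed
qed simp_all

lemma scaleC_scaleR: "c *\<^sub>C (r *\<^sub>R x) = r *\<^sub>R (c *\<^sub>C x)"
  by (metis mult.commute scaleC_of_real scaleC_scaleC)

lemma bounded_linear_scaleC: "bounded_linear (\<lambda>x :: 'a::complex_inner. c *\<^sub>C x)"
  by (rule bounded_linear_intro[where K = "cmod c"])
    (simp_all add: scaleC_add_right scaleC_scaleR norm_scaleC)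

text \<open>The imaginary part of a complex number \<open>z\<close> is the real part of
  \<open>- \<i> * z\<close>, so the real inner product determines the complex one.\<close>

lemma cinner_conv_inner: "cinner x y = Complex (inner x y) (inner (- \<i> *\<^sub>C x) y)"
  unfolding complex_eq_iff inner_eq_Re_cinner cinner_scaleC_left by simp

lemma complex_subspace_imp_subspace: "complex_vector.subspace V \<Longrightarrow> subspace V"
  by (simp add: subspace_def complex_vector.subspace_def scaleC_of_real[symmetric])

lemma orthogonal_projection_scaleC:
  fixes M :: "'a::complex_hilbert set"
  assumes M: "complex_vector.subspace M" "closed M"
  shows "orthogonal_projection M (c *\<^sub>C x) = c *\<^sub>C orthogonal_projection M x"
proof (rule orthogonal_projection_unique)
  note M' = complex_subspace_imp_subspace[OF M(1)] M(2)
  show "subspace M" "closed M" by fact+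
  show "c *\<^sub>C orthogonal_projection M x \<in> M"
    using complex_vector.subspace_scale[OF M(1)] orthogonal_projection_mem[OF M'] by blast
  show "inner (c *\<^sub>C x - c *\<^sub>C orthogonal_projection M x) m = 0" if "m \<in> M" for m
    using orthogonal_projection_orthogonal[OF M', of "cnj c *\<^sub>C m" x]
      complex_vector.subspace_scale[OF M(1) that, of "cnj c"]
    by (simp add: complex_vector.scale_right_diff_distrib[symmetric] inner_scaleC_left)
qed

text \<open>The adjoint for the real inner product is complex linear: moving \<open>c\<close> across
  the inner product conjugates it, and moving it back conjugates it again.\<close>

lemma adjoint_scaleC:
  fixes f :: "'a::complex_hilbert \<Rightarrow> 'b::complex_inner"
  assumes f: "bounded_linear f" "\<And>c x. f (c *\<^sub>C x) = c *\<^sub>C f x"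
  shows "adjoint f (c *\<^sub>C y) = c *\<^sub>C adjoint f y"
proof (rule vector_eq_ldot[THEN iffD1, rule_format])
  note adj = adjoint_works_bounded_linear[OF f(1)]
  fix x
  have "inner x (adjoint f (c *\<^sub>C y)) = inner (cnj c *\<^sub>C f x) y"
    by (simp add: adj inner_scaleC_left)
  also have "\<dots> = inner x (c *\<^sub>C adjoint f y)"
    by (simp add: f(2)[symmetric] adj[symmetric] inner_scaleC_left)
  finally show "inner x (adjoint f (c *\<^sub>C y)) = inner x (c *\<^sub>C adjoint f y)" .
qed

section \<open>Compact maps\<close>

text \<open>A sequence in the closure is shadowed by one in \<open>A\<close> at distances tending to
  0, so both converge along the same subsequence.\<close>

lemma compact_closure_if_convergent_subsequences:
  fixes A :: "'a::metric_space set"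
  assumes A: "\<And>x. (\<And>n::nat. x n \<in> A) \<Longrightarrow> \<exists>l s. strict_mono s \<and> (\<lambda>n. x (s n)) \<longlonglongrightarrow> l"
  shows "compact (closure A)"
  unfolding compact_eq_seq_compact_metric seq_compact_def
proof (intro allI impI)
  fix y :: "nat \<Rightarrow> 'a" assume y: "\<forall>n. y n \<in> closure A"
  have "\<exists>a\<in>A. dist a (y n) < inverse (Suc n)" for n
    using y by (simp add: closure_approachable)
  then obtain x where x: "\<And>n. x n \<in> A" "\<And>n. dist (x n) (y n) < inverse (Suc n)"
    by metis
  obtain l s where s: "strict_mono s" and l: "(\<lambda>n. x (s n)) \<longlonglongrightarrow> l"
    using A x(1) by blast
  have "(\<lambda>n. dist (x n) (y n)) \<longlonglongrightarrow> 0"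
    using less_imp_le[OF x(2)]
    by (intro Lim_null_comparison[OF always_eventually LIMSEQ_inverse_real_of_nat]) simp
  from LIMSEQ_subseq_LIMSEQ[OF this s] have "(\<lambda>n. dist (x (s n)) (y (s n))) \<longlonglongrightarrow> 0"
    by (simp add: o_def)
  from tendsto_add[OF this l[THEN tendsto_dist_iff[THEN iffD1]]]
  have "(\<lambda>n. dist (x (s n)) (y (s n)) + dist (x (s n)) l) \<longlonglongrightarrow> 0"
    by simp
  then have "(\<lambda>n. dist (y (s n)) l) \<longlonglongrightarrow> 0"
    by (rule Lim_null_comparison[OF always_eventually, rotated]) (simp add: dist_triangle3)
  then have "(y \<circ> s) \<longlonglongrightarrow> l"
    by (simp add: tendsto_dist_iff[of _ l] o_def)
  moreover have "l \<in> closure A"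
    unfolding closure_sequential using x(1) l by (intro exI[of _ "\<lambda>n. x (s n)"]) simp
  ultimately show "\<exists>l\<in>closure A. \<exists>r. strict_mono r \<and> (y \<circ> r) \<longlonglongrightarrow> l"
    using s by blast
qed

lemma convergent_subsequence_if_compact_closure:
  fixes A :: "'a::metric_space set" and x :: "nat \<Rightarrow> 'a"
  assumes "compact (closure A)" "\<And>n. x n \<in> A"
  obtains l s where "strict_mono s" "(\<lambda>n. x (s n)) \<longlonglongrightarrow> l"
proof -
  have "\<forall>n. x n \<in> closure A"
    using assms(2) closure_subset by blast
  with assms(1) obtain l s where "strict_mono s" "(x \<circ> s) \<longlonglongrightarrow> l"
    unfolding compact_eq_seq_compact_metric seq_compact_def by metis
  with that show ?thesis
    by (auto simp: o_def)
qed

text \<open>A sequential form of compactness on the whole space, convenient for sums, compositions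
  and adjoints.\<close>

definition compact_map :: "('a::real_normed_vector \<Rightarrow> 'b::real_normed_vector) \<Rightarrow> bool" where
  "compact_map f \<longleftrightarrow> (\<forall>x::nat \<Rightarrow> 'a. bounded (range x) \<longrightarrow>
     (\<exists>l s. strict_mono s \<and> (\<lambda>n. f (x (s n))) \<longlonglongrightarrow> l))"

lemma compact_mapE:
  assumes "compact_map f" "bounded (range x)"
  obtains l s where "strict_mono (s :: nat \<Rightarrow> nat)" "(\<lambda>n. f (x (s n))) \<longlonglongrightarrow> l"
  using assms unfolding compact_map_def by blast

lemma compact_map_add:
  assumes f: "compact_map f" and g: "compact_map g"
  shows "compact_map (\<lambda>x. f x + g x)"
  unfolding compact_map_def
proof (intro allI impI)
  fix x :: "nat \<Rightarrow> 'a" assume x: "bounded (range x)"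
  obtain l s where s: "strict_mono s" and l: "(\<lambda>n. f (x (s n))) \<longlonglongrightarrow> l"
    using compact_mapE[OF f x] .
  have "bounded (range (\<lambda>n. x (s n)))"
    by (rule bounded_subset[OF x]) blast
  then obtain l' s' where s': "strict_mono s'" and l': "(\<lambda>n. g (x (s (s' n)))) \<longlonglongrightarrow> l'"
    using compact_mapE[OF g] by blast
  have "(\<lambda>n. f (x (s (s' n))) + g (x (s (s' n)))) \<longlonglongrightarrow> l + l'"
    using tendsto_add[OF LIMSEQ_subseq_LIMSEQ[OF l s'] l'] by (simp add: o_def)
  then show "\<exists>l r. strict_mono r \<and> (\<lambda>n. f (x (r n)) + g (x (r n))) \<longlonglongrightarrow> l"
    using strict_mono_o[OF s s'] unfolding o_def by (intro exI conjI)
qed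

lemma compact_map_compose_bounded_linear:
  assumes f: "compact_map f" and g: "bounded_linear g"
  shows "compact_map (\<lambda>x. f (g x))"
  unfolding compact_map_def
proof (intro allI impI)
  fix x :: "nat \<Rightarrow> 'c" assume "bounded (range x)"
  then have "bounded (range (\<lambda>n. g (x n)))"
    using bounded_linear_image[OF _ g] by (metis image_image)
  then show "\<exists>l s. strict_mono s \<and> (\<lambda>n. f (g (x (s n)))) \<longlonglongrightarrow> l"
    using f unfolding compact_map_def by blast
qed

text \<open>Schauder's theorem in Hilbert space. The square of \<open>norm (adjoint f d)\<close> is
  at most \<open>norm (f (adjoint f d)) * norm d\<close>, so convergence of the images under the
  compact map \<open>f\<close> composed with \<open>adjoint f\<close> makes the images under
  \<open>adjoint f\<close> Cauchy.\<close>

lemma compact_map_adjoint: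
  fixes f :: "'a::{real_inner,complete_space} \<Rightarrow> 'b::real_inner"
  assumes f: "bounded_linear f" and cf: "compact_map f"
  shows "compact_map (adjoint f)"
  unfolding compact_map_def
proof (intro allI impI)
  fix x :: "nat \<Rightarrow> 'b" assume x: "bounded (range x)"
  note adj = adjoint_works_bounded_linear[OF f] and badj = bounded_linear_adjoint[OF f]
  interpret f: bounded_linear f by fact
  interpret a: bounded_linear "adjoint f" by fact
  obtain K where K: "K > 0" "\<And>n. norm (x n) \<le> K"
    using x by (auto simp: bounded_pos)
  obtain l s where s: "strict_mono s" and l: "(\<lambda>n. f (adjoint f (x (s n)))) \<longlonglongrightarrow> l"
    using compact_mapE[OF compact_map_compose_bounded_linear[OF cf badj] x] .
  have "Cauchy (\<lambda>n. adjoint f (x (s n)))"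
  proof (rule metric_CauchyI)
    fix e :: real assume e: "e > 0"
    \<comment> \<open>Differences of terms of \<open>x\<close> have norm at most
      \<open>2 * K\<close>; this tolerance leaves less than \<open>e\<^sup>2\<close> after
      multiplication by that bound.\<close>
    then have "e\<^sup>2 / (2 * K) > 0" using K by simp
    then obtain N where N: "\<And>m n. m \<ge> N \<Longrightarrow> n \<ge> N \<Longrightarrow>
        dist (f (adjoint f (x (s m)))) (f (adjoint f (x (s n)))) < e\<^sup>2 / (2 * K)"
      using metric_CauchyD[OF LIMSEQ_imp_Cauchy[OF l]] by metis
    have "dist (adjoint f (x (s m))) (adjoint f (x (s n))) < e" if "m \<ge> N" "n \<ge> N" for m n
    proof -
      define d where "d = x (s m) - x (s n)"
      have d: "norm d \<le> 2 * K"
        using norm_triangle_ineq4[of "x (s m)" "x (s n)"] K(2)[of "s m"] K(2)[of "s n"]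
        by (simp add: d_def)
      have "(norm (adjoint f d))\<^sup>2 = inner (f (adjoint f d)) d"
        by (simp add: power2_norm_eq_inner adj)
      also have "\<dots> \<le> norm (f (adjoint f d)) * norm d"
        by (rule norm_cauchy_schwarz)
      also have "\<dots> \<le> norm (f (adjoint f d)) * (2 * K)"
        by (intro mult_left_mono d) simp
      also have "\<dots> < e\<^sup>2"
        using N[OF that] K(1) by (simp add: d_def dist_norm a.diff f.diff field_simps)
      finally have "norm (adjoint f d) < e"
        using e by (simp add: power_less_imp_less_base)
      then show ?thesis
        by (simp add: d_def dist_norm a.diff)
    qed
    then show "\<exists>N. \<forall>m\<ge>N. \<forall>n\<ge>N. dist (adjoint f (x (s m))) (adjoint f (x (s n))) < e"
      by blast
  qed
  then show "\<exists>l s. strict_mono s \<and> (\<lambda>n. adjoint f (x (s n))) \<longlonglongrightarrow> l"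
    using s by (auto simp: Cauchy_convergent_iff convergent_def)
qed

section \<open>Unbounded symmetric and self-adjoint operators\<close>

context
  fixes T :: "'h::complex_inner \<rightharpoonup> 'h"
  assumes T: "linear_operator T"
begin

lemma linear_operator_csubspace_dom: "complex_vector.subspace (dom T)"
  using T by (simp add: linear_operator_def clinear_on_def)

lemma linear_operator_subspace_dom: "subspace (dom T)"
  by (intro complex_subspace_imp_subspace linear_operator_csubspace_dom)

lemma linear_operator_add:
  "x \<in> dom T \<Longrightarrow> y \<in> dom T \<Longrightarrow> the (T (x + y)) = the (T x) + the (T y)"
  using T by (simp add: linear_operator_def clinear_on_def)

lemma linear_operator_scaleC: "x \<in> dom T \<Longrightarrow> the (T (c *\<^sub>C x)) = c *\<^sub>C the (T x)"
  using T by (simp add: linear_operator_def clinear_on_def)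

lemma linear_operator_scaleR: "x \<in> dom T \<Longrightarrow> the (T (c *\<^sub>R x)) = c *\<^sub>R the (T x)"
  using linear_operator_scaleC[of x "of_real c"] by (simp add: scaleC_of_real)

lemma linear_operator_diff:
  "x \<in> dom T \<Longrightarrow> y \<in> dom T \<Longrightarrow> the (T (x - y)) = the (T x) - the (T y)"
  using linear_operator_add[of x "-1 *\<^sub>R y"] linear_operator_scaleR[of y "-1"]
    subspace_neg[OF linear_operator_subspace_dom, of y]
  by simp

lemma clinear_on_shift: "clinear_on (dom T) (\<lambda>x. the (T x) - c *\<^sub>C x)"
  unfolding clinear_on_def
  by (simp add: linear_operator_csubspace_dom linear_operator_add linear_operator_scaleC
      scaleC_scaleC scaleC_add_right complex_vector.scale_right_diff_distrib mult.commute)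

text \<open>The domain is a complex subspace, so the real condition may be applied to
  \<open>- \<i> *\<^sub>C x\<close> as well, which gives the imaginary part.\<close>

lemma complex_inner_condition_iff:
  "(\<forall>x\<in>dom T. cinner (the (T x)) y = cinner x z) \<longleftrightarrow> (\<forall>x\<in>dom T. inner (the (T x)) y = inner x z)"
proof
  assume *: "\<forall>x\<in>dom T. inner (the (T x)) y = inner x z"
  show "\<forall>x\<in>dom T. cinner (the (T x)) y = cinner x z"
  proof
    fix x assume x: "x \<in> dom T"
    then have "- \<i> *\<^sub>C x \<in> dom T"
      by (rule complex_vector.subspace_scale[OF linear_operator_csubspace_dom])
    with x * have "inner (- \<i> *\<^sub>C the (T x)) y = inner (- \<i> *\<^sub>C x) z"
      by (metis linear_operator_scaleC)
    with x * show "cinner (the (T x)) y = cinner x z"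
      by (simp only: cinner_conv_inner)
  qed
qed (simp add: inner_eq_Re_cinner)

text \<open>Density makes \<open>z\<close> unique, so the description in
  \<open>adjoint_operator\<close> denotes it and the graph of the adjoint is given by the real
  condition.\<close>

lemma adjoint_operator_eq_Some_iff:
  assumes dense: "densely_defined T"
  shows "adjoint_operator T y = Some z \<longleftrightarrow> (\<forall>x\<in>dom T. inner (the (T x)) y = inner x z)"
proof -
  define Q where "Q z \<longleftrightarrow> (\<forall>x\<in>dom T. inner (the (T x)) y = inner x z)" for z
  have uniq: "z = z'" if "Q z" "Q z'" for z z'
    using that dense unfolding Q_def densely_defined_def by (metis inner_eq_on_dense_imp_eq)
  have "adjoint_operator T y = (if \<exists>z. Q z then Some (THE z. Q z) else None)"
    unfolding adjoint_operator_def complex_inner_condition_iff Q_def ..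
  moreover have "(THE z. Q z) = z" if "Q z" for z
    using that uniq by blast
  ultimately show ?thesis
    unfolding Q_def[symmetric] by auto
qed

end

lemma csubspace_clinear_image:
  assumes f: "clinear_on D f"
  shows "complex_vector.subspace (f ` D)"
proof (rule complex_vector.subspaceI)
  have D: "complex_vector.subspace D"
    using f by (simp add: clinear_on_def)
  have "f 0 = f (0 *\<^sub>C 0)" by simp
  also have "\<dots> = 0"
    using f complex_vector.subspace_0[OF D] by (metis clinear_on_def complex_vector.scale_zero_left)
  finally show "0 \<in> f ` D"
    using complex_vector.subspace_0[OF D] by (metis imageI)
  show "u + v \<in> f ` D" if "u \<in> f ` D" "v \<in> f ` D" for u v
    using that f complex_vector.subspace_add[OF D] unfolding clinear_on_def
    by clarify (metis imageI)
  show "c *\<^sub>C u \<in> f ` D" if "u \<in> f ` D" for c u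
    using that f complex_vector.subspace_scale[OF D] unfolding clinear_on_def
    by clarify (metis imageI)
qed

lemma the_minus_scalar: "x \<in> dom T \<Longrightarrow> the (minus_scalar T c x) = the (T x) - c *\<^sub>C x"
  by (auto simp: minus_scalar_def)

lemma clinear_on_the_inv_into:
  assumes f: "clinear_on D f" and bij: "bij_betw f D UNIV"
  shows "clinear_on UNIV (the_inv_into D f)"
proof -
  have inj: "inj_on f D" and surj: "f ` D = UNIV"
    using bij by (auto simp: bij_betw_def)
  have D: "complex_vector.subspace D"
    using f by (simp add: clinear_on_def)
  have mem: "the_inv_into D f x \<in> D" and inv: "f (the_inv_into D f x) = x" for x
    using the_inv_into_into[OF inj, of x D] f_the_inv_into_f[OF inj, of x] surj by auto
  have "the_inv_into D f (x + y) = the_inv_into D f x + the_inv_into D f y" for x y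
    using f by (intro the_inv_into_f_eq inj)
      (simp_all add: clinear_on_def mem inv complex_vector.subspace_add[OF D])
  moreover have "the_inv_into D f (c *\<^sub>C x) = c *\<^sub>C the_inv_into D f x" for c x
    using f by (intro the_inv_into_f_eq inj)
      (simp_all add: clinear_on_def mem inv complex_vector.subspace_scale[OF D])
  ultimately show ?thesis
    by (simp add: clinear_on_def)
qed

section \<open>Self-adjoint operators and their resolvent at the imaginary unit\<close>

context
  fixes S :: "'h::complex_hilbert \<rightharpoonup> 'h"
  assumes S: "self_adjoint S"
begin

lemma self_adjoint_linear_operator: "linear_operator S"
  using S by (simp add: self_adjoint_def)

lemma self_adjoint_eq_Some_iff: "S y = Some z \<longleftrightarrow> (\<forall>x\<in>dom S. inner (the (S x)) y = inner x z)"
  using S adjoint_operator_eq_Some_iff[of S y z] by (simp add: self_adjoint_def)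

lemma self_adjoint_inner:
  "x \<in> dom S \<Longrightarrow> y \<in> dom S \<Longrightarrow> inner (the (S x)) y = inner x (the (S y))"
  using self_adjoint_eq_Some_iff[of y "the (S y)"] by auto

text \<open>The cross term vanishes: symmetry shows that the real inner product of
  \<open>the (S x)\<close> and \<open>\<i> *\<^sub>C x\<close> equals its own negative.\<close>

lemma self_adjoint_norm_shift:
  assumes x: "x \<in> dom S"
  shows "(norm (the (S x) - \<i> *\<^sub>C x))\<^sup>2 = (norm (the (S x)))\<^sup>2 + (norm x)\<^sup>2"
proof -
  have "\<i> *\<^sub>C x \<in> dom S"
    using complex_vector.subspace_scale[OF linear_operator_csubspace_dom] x
      self_adjoint_linear_operator by blast
  then have "inner (the (S x)) (\<i> *\<^sub>C x) = inner x (\<i> *\<^sub>C the (S x))"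
    using x by (simp add: self_adjoint_inner linear_operator_scaleC[OF self_adjoint_linear_operator])
  also have "\<dots> = - inner (the (S x)) (\<i> *\<^sub>C x)"
    using inner_scaleC_left[of \<i> "the (S x)" x] by (simp add: inner_commute)
  finally have "inner (the (S x)) (\<i> *\<^sub>C x) = 0" by simp
  then have "(norm (the (S x) - \<i> *\<^sub>C x))\<^sup>2 = (norm (the (S x)))\<^sup>2 + (norm (\<i> *\<^sub>C x))\<^sup>2"
    by (simp add: power2_norm_eq_inner inner_diff_left inner_diff_right inner_commute)
  then show ?thesis by (simp add: norm_scaleC)
qed

text \<open>Adjoints are closed: the condition characterising the graph is preserved under limits of
  both components.\<close>

lemma self_adjoint_closed:
  assumes x: "\<And>n::nat. x n \<in> dom S" and lim: "x \<longlonglongrightarrow> l" "(\<lambda>n. the (S (x n))) \<longlonglongrightarrow> m"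
  shows "S l = Some m"
  unfolding self_adjoint_eq_Some_iff
proof
  fix v assume v: "v \<in> dom S"
  have "(\<lambda>n. inner (the (S v)) (x n)) \<longlonglongrightarrow> inner (the (S v)) l"
    by (intro tendsto_intros lim)
  moreover have "(\<lambda>n. inner (the (S v)) (x n)) \<longlonglongrightarrow> inner v m"
    using tendsto_inner[OF tendsto_const lim(2), of v] by (simp add: self_adjoint_inner x v)
  ultimately show "inner (the (S v)) l = inner v m"
    by (rule LIMSEQ_unique)
qed

text \<open>The norm identity bounds \<open>x\<close> and \<open>the (S x)\<close> by the image of
  \<open>x\<close>. This yields injectivity and, as \<open>S\<close> is closed, a closed range;
  self-adjointness makes the orthogonal complement of the range trivial.\<close>

lemma self_adjoint_bij_betw_shift: "bij_betw (\<lambda>x. the (S x) - \<i> *\<^sub>C x) (dom S) UNIV"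
proof -
  let ?f = "\<lambda>x. the (S x) - \<i> *\<^sub>C x"
  note lin = self_adjoint_linear_operator
  note D = linear_operator_subspace_dom[OF lin]
  have diff: "?f x - ?f y = ?f (x - y)" if "x \<in> dom S" "y \<in> dom S" for x y
    using that by (simp add: linear_operator_diff[OF lin] complex_vector.scale_right_diff_distrib)
  have le: "norm x \<le> norm (?f x)" "norm (the (S x)) \<le> norm (?f x)" if "x \<in> dom S" for x
    by (auto simp: self_adjoint_norm_shift[OF that] intro: power2_le_imp_le[OF _ norm_ge_zero])
  have "inj_on ?f (dom S)"
  proof (rule inj_onI)
    fix x y assume xy: "x \<in> dom S" "y \<in> dom S" "?f x = ?f y"
    with le(1)[OF subspace_diff[OF D xy(1,2)]] diff[OF xy(1,2)] show "x = y"
      by simp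
  qed
  moreover have "?f ` dom S = UNIV"
  proof -
    define R where "R = ?f ` dom S"
    have "subspace R"
      unfolding R_def
      by (rule complex_subspace_imp_subspace[OF csubspace_clinear_image[OF clinear_on_shift[OF lin]]])
    moreover have "closed R"
      unfolding closed_sequential_limits
    proof (intro allI impI, elim conjE)
      fix y l assume y: "\<forall>n. y n \<in> R" and l: "y \<longlonglongrightarrow> l"
      from y have "\<forall>n. \<exists>x. x \<in> dom S \<and> y n = ?f x"
        unfolding R_def by blast
      then obtain x where x: "\<And>n. x n \<in> dom S" "\<And>n. y n = ?f (x n)"
        by metis
      have d: "dist (x m) (x n) \<le> dist (y m) (y n)"
        "dist (the (S (x m))) (the (S (x n))) \<le> dist (y m) (y n)" for m n
        using le[OF subspace_diff[OF D x(1)[of m] x(1)[of n]]] x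
        by (simp_all add: dist_norm diff linear_operator_diff[OF lin, symmetric])
      have "Cauchy x" "Cauchy (\<lambda>n. the (S (x n)))"
        using LIMSEQ_imp_Cauchy[OF l] d unfolding Cauchy_def by (meson le_less_trans)+
      then obtain p q where pq: "x \<longlonglongrightarrow> p" "(\<lambda>n. the (S (x n))) \<longlonglongrightarrow> q"
        by (auto simp: Cauchy_convergent_iff convergent_def)
      have "S p = Some q"
        using self_adjoint_closed[OF x(1) pq] .
      have "(\<lambda>n. ?f (x n)) \<longlonglongrightarrow> q - \<i> *\<^sub>C p"
        by (rule tendsto_diff[OF pq(2) bounded_linear.tendsto[OF bounded_linear_scaleC pq(1)]])
      then have "y \<longlonglongrightarrow> q - \<i> *\<^sub>C p"
        by (simp only: x(2)[symmetric])
      then have "l = ?f p"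
        using LIMSEQ_unique[OF l] \<open>S p = Some q\<close> by simp
      then show "l \<in> R"
        unfolding R_def using \<open>S p = Some q\<close> by (intro image_eqI[of l _ p]) auto
    qed
    ultimately have R: "subspace R" "closed R" .
    have zero: "y = 0" if y: "\<And>m. m \<in> R \<Longrightarrow> inner y m = 0" for y
    proof -
      \<comment> \<open>Orthogonality to the range says that the adjoint sends \<open>y\<close> to
        \<open>- \<i> *\<^sub>C y\<close>. As \<open>S\<close> is its own adjoint, \<open>y\<close>
        is in its domain.\<close>
      have "inner (the (S x)) y = inner x (- \<i> *\<^sub>C y)" if "x \<in> dom S" for x
      proof -
        have "inner (?f x) y = 0"
          using y[of "?f x"] that by (simp add: R_def inner_commute)
        then show ?thesis
          by (simp add: inner_diff_left inner_scaleC_left)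
      qed
      then have Sy: "S y = Some (- \<i> *\<^sub>C y)"
        by (simp add: self_adjoint_eq_Some_iff)
      \<comment> \<open>With \<open>S y = Some (- \<i> *\<^sub>C y)\<close> the norm identity says
        that four times the square of \<open>norm y\<close> equals twice that square, so
        \<open>y = 0\<close>.\<close>
      have "(norm (- \<i> *\<^sub>C y - \<i> *\<^sub>C y))\<^sup>2 = (norm (- \<i> *\<^sub>C y))\<^sup>2 + (norm y)\<^sup>2"
        using self_adjoint_norm_shift[of y] Sy by (simp only: domI option.sel)
      then have "(norm ((- \<i> - \<i>) *\<^sub>C y))\<^sup>2 = (norm (- \<i> *\<^sub>C y))\<^sup>2 + (norm y)\<^sup>2"
        by (simp only: complex_vector.scale_left_diff_distrib)
      moreover have "cmod (- \<i> - \<i>) = 2"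
        by (simp add: cmod_def)
      ultimately show "y = 0"
        by (simp add: norm_scaleC power_mult_distrib del: complex_vector.scale_minus_left)
    qed
    have "x \<in> R" for x
    proof -
      have "x - orthogonal_projection R x = 0"
        by (intro zero orthogonal_projection_orthogonal R)
      then show ?thesis
        using orthogonal_projection_mem[OF R, of x] by simp
    qed
    then show ?thesis
      by (auto simp: R_def)
  qed
  ultimately show ?thesis by (simp add: bij_betw_def)
qed

lemma self_adjoint_bij_betw_minus_scalar:
  "bij_betw (\<lambda>x. the (minus_scalar S \<i> x)) (dom S) UNIV"
  using self_adjoint_bij_betw_shift by (simp add: the_minus_scalar cong: bij_betw_cong)

lemma clinear_on_resolvent: "clinear_on UNIV (resolvent S \<i>)"
  unfolding resolvent_def
  using clinear_on_shift[OF self_adjoint_linear_operator, of \<i>]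
  by (intro clinear_on_the_inv_into self_adjoint_bij_betw_minus_scalar)
     (auto simp: clinear_on_def the_minus_scalar complex_vector.subspace_add complex_vector.subspace_scale)

lemma resolvent_eqI: "x \<in> dom S \<Longrightarrow> resolvent S \<i> (the (S x) - \<i> *\<^sub>C x) = x"
  using the_inv_into_f_f[OF bij_betw_imp_inj_on[OF self_adjoint_bij_betw_minus_scalar], of x]
  by (simp add: resolvent_def the_minus_scalar)

end

section \<open>From a compact resolvent to a compact embedding\<close>

lemma domain_compactly_embedded_if_compact_resolvent:
  fixes T :: "'h::complex_hilbert \<rightharpoonup> 'h"
  assumes T: "linear_operator T" and S: "self_adjoint_extension T S" and R: "compact_resolvent S"
  shows "domain_compactly_embedded T"
proof -
  have sa: "self_adjoint S" and TS: "T \<subseteq>\<^sub>m S"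
    using S by (auto simp: self_adjoint_extension_def)
  let ?A = "{x \<in> dom T. graph_norm T x \<le> 1}" and ?B = "resolvent S \<i> ` {x. norm x \<le> 1}"
  have "?A \<subseteq> ?B"
  proof
    fix x assume "x \<in> ?A"
    then have x: "x \<in> dom T" and n: "(norm x)\<^sup>2 + (norm (the (T x)))\<^sup>2 \<le> 1"
      by (auto simp: graph_norm_def)
    have Sx: "S x = T x" "x \<in> dom S"
      using x TS by (auto simp: map_le_def) (metis domI)
    then have "(norm (the (S x) - \<i> *\<^sub>C x))\<^sup>2 \<le> 1\<^sup>2"
      using n by (subst self_adjoint_norm_shift[OF sa Sx(2)]) (simp add: Sx(1) add.commute)
    then have "norm (the (S x) - \<i> *\<^sub>C x) \<le> 1"
      by (rule power2_le_imp_le) simp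
    then show "x \<in> ?B"
      using imageI[of "the (S x) - \<i> *\<^sub>C x" "{x. norm x \<le> 1}" "resolvent S \<i>"]
        resolvent_eqI[OF sa Sx(2)] by simp
  qed
  then have "closure ?A \<subseteq> closure ?B" by (rule closure_mono)
  moreover have "compact (closure ?B)"
    using R by (simp add: compact_resolvent_def compact_linear_on_def)
  ultimately have "compact (closure ?A)"
    using compact_Int_closed[of "closure ?B" "closure ?A"] by (simp add: Int_absorb1)
  then show ?thesis
    using linear_operator_csubspace_dom[OF T]
    by (simp add: domain_compactly_embedded_def compact_linear_on_def clinear_on_def)
qed

section \<open>Self-adjoint extensions with compact resolvent\<close>

context
  fixes T :: "'h::complex_hilbert \<rightharpoonup> 'h"
  assumes T: "linear_operator T" and emb: "domain_compactly_embedded T"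
begin

lemma compactly_embedded_subsequence:
  assumes x: "\<And>n. x n \<in> dom T" "\<And>n. norm (x n) \<le> K" "\<And>n. norm (the (T (x n))) \<le> K"
  obtains l s where "strict_mono (s :: nat \<Rightarrow> nat)" "(\<lambda>n. x (s n)) \<longlonglongrightarrow> l"
proof -
  \<comment> \<open>Division by \<open>c\<close> brings the sum of both norms, at most
    \<open>2 * K\<close>, below 1, and that sum dominates the graph norm. The summand 1 keeps
    \<open>c\<close> positive when \<open>K = 0\<close>.\<close>
  define c where "c = 2 * K + 1"
  have c: "c > 0"
    using order_trans[OF norm_ge_zero x(2)[of 0]] by (simp add: c_def)
  define u where "u n = inverse c *\<^sub>R x n" for n
  have u: "u n \<in> {x \<in> dom T. graph_norm T x \<le> 1}" for n
  proof -
    have "graph_norm T (u n) \<le> norm (u n) + norm (the (T (u n)))"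
      unfolding graph_norm_def by (rule sqrt_sum_squares_le_sum) simp_all
    also have "\<dots> = (norm (x n) + norm (the (T (x n)))) / c"
      using c by (simp add: u_def linear_operator_scaleR[OF T x(1)] field_simps)
    also have "\<dots> \<le> 1"
      using c x(2)[of n] x(3)[of n] by (simp add: c_def)
    finally show ?thesis
      using subspace_scale[OF linear_operator_subspace_dom[OF T] x(1)] by (simp add: u_def)
  qed
  have "compact (closure {x \<in> dom T. graph_norm T x \<le> 1})"
    using emb by (simp add: domain_compactly_embedded_def compact_linear_on_def)
  then obtain l s where s: "strict_mono s" "(\<lambda>n. u (s n)) \<longlonglongrightarrow> l"
    by (rule convergent_subsequence_if_compact_closure[where x = u, OF _ u])
  have "(\<lambda>n. c *\<^sub>R u (s n)) \<longlonglongrightarrow> c *\<^sub>R l"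
    by (intro tendsto_intros s)
  then show ?thesis
    using that[OF s(1), of "c *\<^sub>R l"] c by (simp add: u_def)
qed

text \<open>Eigenvectors for the eigenvalues \<open>1 / (n + 1)\<close> would form an orthonormal sequence that is
  bounded in the graph norm.\<close>

lemma exists_real_non_eigenvalue:
  assumes sym: "symmetric_operator T"
  obtains r :: real where "\<And>x. x \<in> dom T \<Longrightarrow> the (T x) = r *\<^sub>R x \<Longrightarrow> x = 0"
proof (rule ccontr)
  assume "\<not> thesis"
  then have "\<exists>x. x \<in> dom T \<and> the (T x) = r *\<^sub>R x \<and> x \<noteq> 0" for r :: real
    using that by blast
  then have "\<forall>r::real. \<exists>x. x \<in> dom T \<and> the (T x) = r *\<^sub>R x \<and> x \<noteq> 0"
    by blast
  then obtain v where v: "\<And>r::real. v r \<in> dom T" "\<And>r. the (T (v r)) = r *\<^sub>R v r" "\<And>r. v r \<noteq> 0"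
    by metis
  define e where "e n = inverse (norm (v (inverse (Suc n)))) *\<^sub>R v (inverse (Suc n))" for n :: nat
  have e: "e n \<in> dom T" "the (T (e n)) = inverse (Suc n) *\<^sub>R e n" "norm (e n) = 1" for n
    using subspace_scale[OF linear_operator_subspace_dom[OF T] v(1)]
    by (simp_all add: e_def linear_operator_scaleR[OF T v(1)] v(2,3))
  have Te: "norm (the (T (e n))) \<le> 1" for n
    unfolding e(2) norm_scaleR e(3) by (simp add: inverse_le_1_iff)
  obtain l s where s: "strict_mono s" and l: "(\<lambda>n. e (s n)) \<longlonglongrightarrow> l"
    by (rule compactly_embedded_subsequence[where x = e, OF e(1) eq_refl[OF e(3)] Te])
  \<comment> \<open>Eigenvectors of a symmetric operator for distinct real eigenvalues are
    orthogonal. Distinct members of an orthonormal sequence stay \<open>sqrt 2\<close> apart, so no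
    subsequence is Cauchy.\<close>
  have dist: "dist (e m) (e n) = sqrt 2" if "m \<noteq> n" for m n
  proof -
    have "inner (the (T (e m))) (e n) = inner (e m) (the (T (e n)))"
      using sym e(1) by (simp add: symmetric_operator_def inner_eq_Re_cinner)
    then have "(inverse (Suc m) - inverse (Suc n)) * inner (e m) (e n) = 0"
      by (simp add: e(2) left_diff_distrib del: of_nat_Suc)
    then have "inner (e m) (e n) = 0"
      using that by simp
    moreover have "inner (e k) (e k) = 1" for k
      using e(3)[of k] by (simp add: norm_eq_1)
    ultimately show ?thesis
      by (simp add: dist_norm norm_eq_sqrt_inner inner_diff_left inner_diff_right inner_commute)
  qed
  obtain N where "\<And>m n. m \<ge> N \<Longrightarrow> n \<ge> N \<Longrightarrow> dist (e (s m)) (e (s n)) < 1"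
    using metric_CauchyD[OF LIMSEQ_imp_Cauchy[OF l], of 1] by auto
  from this[of N "Suc N"] dist[of "s N" "s (Suc N)"] strict_monoD[OF s, of N "Suc N"]
  show False by simp
qed

text \<open>Otherwise there are unit vectors on which \<open>T - r\<close> tends to 0. They are
  bounded in the graph norm, so a subsequence converges to a unit vector, and closedness of
  \<open>T\<close> makes that limit an eigenvector for \<open>r\<close>.\<close>

lemma bounded_below_if_non_eigenvalue:
  assumes cl: "closed_operator T"
    and r: "\<And>x. x \<in> dom T \<Longrightarrow> the (T x) = r *\<^sub>R x \<Longrightarrow> x = 0"
  obtains c where "c > 0" "\<And>x. x \<in> dom T \<Longrightarrow> c * norm x \<le> norm (the (T x) - r *\<^sub>R x)"
proof (rule ccontr)
  assume "\<not> thesis"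
  then have "\<forall>c>0. \<exists>x. x \<in> dom T \<and> norm (the (T x) - r *\<^sub>R x) < c * norm x"
    using that by (metis not_le)
  then have "\<forall>n. \<exists>x. x \<in> dom T \<and> norm (the (T x) - r *\<^sub>R x) < inverse (Suc n) * norm x"
    by simp
  then obtain v where v: "\<And>n::nat. v n \<in> dom T"
      "\<And>n. norm (the (T (v n)) - r *\<^sub>R v n) < inverse (Suc n) * norm (v n)"
    by metis
  have v0: "norm (v n) > 0" for n
    using le_less_trans[OF norm_ge_zero v(2)[of n]] by (simp add: zero_less_mult_iff)
  define e where "e n = inverse (norm (v n)) *\<^sub>R v n" for n
  have e: "e n \<in> dom T" "norm (e n) = 1" for n
    using v0[of n] subspace_scale[OF linear_operator_subspace_dom[OF T] v(1)]
    by (simp_all add: e_def)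
  have Te: "norm (the (T (e n)) - r *\<^sub>R e n) \<le> inverse (Suc n)" for n
  proof -
    have "the (T (e n)) - r *\<^sub>R e n = inverse (norm (v n)) *\<^sub>R (the (T (v n)) - r *\<^sub>R v n)"
      by (simp add: e_def linear_operator_scaleR[OF T v(1)] scaleR_right_diff_distrib)
    then have "norm (the (T (e n)) - r *\<^sub>R e n) = norm (the (T (v n)) - r *\<^sub>R v n) / norm (v n)"
      by (simp add: divide_inverse_commute)
    also have "\<dots> \<le> inverse (Suc n)"
      using v(2)[of n] v0[of n] by (simp add: pos_divide_le_eq del: of_nat_Suc)
    finally show ?thesis .
  qed
  have Te_le: "norm (the (T (e n))) \<le> 1 + \<bar>r\<bar>" for n
  proof -
    have "norm (the (T (e n))) \<le> norm (the (T (e n)) - r *\<^sub>R e n) + norm (r *\<^sub>R e n)"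
      using norm_triangle_ineq[of "the (T (e n)) - r *\<^sub>R e n" "r *\<^sub>R e n"] by simp
    moreover have "inverse (real (Suc n)) \<le> 1"
      by (simp add: inverse_le_1_iff)
    ultimately show ?thesis
      using Te[of n] e(2)[of n] by simp
  qed
  have "norm (e n) \<le> 1 + \<bar>r\<bar>" for n
    by (simp add: e(2))
  then obtain l s where s: "strict_mono s" and l: "(\<lambda>n. e (s n)) \<longlonglongrightarrow> l"
    by (rule compactly_embedded_subsequence[where x = e, OF e(1) _ Te_le])
  have "(\<lambda>n. the (T (e n)) - r *\<^sub>R e n) \<longlonglongrightarrow> 0"
    using Te by (intro Lim_null_comparison[OF always_eventually LIMSEQ_inverse_real_of_nat]) simp
  \<comment> \<open>\<open>T\<close> is split as \<open>(T - r) + r\<close>: the first part tends to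
    0 and the second to \<open>r *\<^sub>R l\<close>.\<close>
  from LIMSEQ_subseq_LIMSEQ[OF this s] tendsto_scaleR[OF tendsto_const[of r] l]
  have Tl: "(\<lambda>n. the (T (e (s n)))) \<longlonglongrightarrow> r *\<^sub>R l"
    using tendsto_add by (fastforce simp: o_def)
  have "(e (s n), the (T (e (s n)))) \<in> Map.graph T" for n
    using e(1)[of "s n"] by (auto simp: Map.graph_def)
  then have "(l, r *\<^sub>R l) \<in> Map.graph T"
    using closed_sequentially[OF cl[unfolded closed_operator_def] _ tendsto_Pair[OF l Tl]] by blast
  then have "l \<in> dom T" "the (T l) = r *\<^sub>R l"
    by (auto simp: Map.graph_def)
  then have "l = 0" by (rule r)
  moreover have "norm l = 1"
    using tendsto_norm[OF l] by (simp add: e(2) LIMSEQ_const_iff)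
  ultimately show False by simp
qed

end

section \<open>Self-adjoint operators obtained by inverting a bounded symmetric map\<close>

text \<open>\<open>inv B\<close> is a genuine inverse only for injective \<open>B\<close>; below, injectivity comes from the symmetry and
  the dense range of \<open>B\<close>.\<close>

definition inverse_plus_scalar :: "('h::complex_inner \<Rightarrow> 'h) \<Rightarrow> real \<Rightarrow> ('h \<rightharpoonup> 'h)" where
  "inverse_plus_scalar B r = (\<lambda>x. if x \<in> range B then Some (inv B x + r *\<^sub>R x) else None)"

lemma dom_inverse_plus_scalar: "dom (inverse_plus_scalar B r) = range B"
  by (auto simp: inverse_plus_scalar_def dom_def)

context
  fixes B :: "'h::complex_inner \<Rightarrow> 'h" and r :: real
  assumes B: "clinear_on UNIV B" and sym: "\<And>x y. inner (B x) y = inner x (B y)"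
    and dense: "closure (range B) = UNIV"
begin

text \<open>By symmetry, two vectors with the same image have the same inner products with the dense
  range.\<close>

lemma inj_if_symmetric_dense_range: "inj B"
proof (rule injI)
  fix x y assume "B x = B y"
  then have "inner (B v) x = inner (B v) y" for v
    by (simp add: sym)
  then show "x = y"
    by (intro inner_eq_on_dense_imp_eq[OF dense]) auto
qed

lemma inverse_plus_scalar_apply: "inverse_plus_scalar B r (B v) = Some (v + r *\<^sub>R B v)"
  by (simp add: inverse_plus_scalar_def inv_f_f[OF inj_if_symmetric_dense_range])

lemma linear_operator_inverse_plus_scalar: "linear_operator (inverse_plus_scalar B r)"
proof -
  have add: "B x + B y = B (x + y)" and scale: "c *\<^sub>C B x = B (c *\<^sub>C x)" for x y c
    using B by (simp_all add: clinear_on_def)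
  show ?thesis
    unfolding linear_operator_def clinear_on_def dom_inverse_plus_scalar
  proof (intro conjI ballI allI)
    show "complex_vector.subspace (range B)"
      using csubspace_clinear_image[OF B] .
    fix x y assume "x \<in> range B" "y \<in> range B"
    then obtain u v where xy: "x = B u" "y = B v" by blast
    show "the (inverse_plus_scalar B r (x + y)) =
        the (inverse_plus_scalar B r x) + the (inverse_plus_scalar B r y)"
      by (simp add: xy add inverse_plus_scalar_apply) (simp add: add[symmetric] scaleR_add_right)
  next
    fix c x assume "x \<in> range B"
    then obtain u where x: "x = B u" by blast
    show "the (inverse_plus_scalar B r (c *\<^sub>C x)) = c *\<^sub>C the (inverse_plus_scalar B r x)"
      by (simp add: x scale inverse_plus_scalar_apply)
        (simp add: scale[symmetric] scaleC_add_right scaleC_scaleR)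
  qed
qed

text \<open>Writing the elements of the domain as \<open>B v\<close> turns the adjoint condition
  into one quantified over all \<open>v\<close>. Since \<open>B\<close> is defined everywhere,
  symmetry moves it to the other side without any domain restriction, and what remains is exactly
  membership in the graph.\<close>

lemma self_adjoint_inverse_plus_scalar: "self_adjoint (inverse_plus_scalar B r)"
proof -
  let ?S = "inverse_plus_scalar B r"
  note lin = linear_operator_inverse_plus_scalar
  have dd: "densely_defined ?S"
    by (simp add: densely_defined_def dom_inverse_plus_scalar dense)
  have "adjoint_operator ?S y = Some z \<longleftrightarrow> ?S y = Some z" for y z
  proof -
    have "adjoint_operator ?S y = Some z \<longleftrightarrow> (\<forall>v. inner (v + r *\<^sub>R B v) y = inner (B v) z)"
      by (simp add: adjoint_operator_eq_Some_iff[OF lin dd] dom_inverse_plus_scalar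
          inverse_plus_scalar_apply)
    also have "\<dots> \<longleftrightarrow> (\<forall>v. inner v y = inner v (B (z - r *\<^sub>R y)))"
      by (simp add: sym[symmetric] inner_diff_right inner_add_left algebra_simps)
    also have "\<dots> \<longleftrightarrow> y = B (z - r *\<^sub>R y)"
      by (rule vector_eq_ldot)
    also have "\<dots> \<longleftrightarrow> ?S y = Some z"
    proof
      assume "y = B (z - r *\<^sub>R y)"
      then show "?S y = Some z"
        using inverse_plus_scalar_apply[of "z - r *\<^sub>R y"] by simp
    next
      assume *: "?S y = Some z"
      then have "y \<in> range B"
        using dom_inverse_plus_scalar by blast
      then show "y = B (z - r *\<^sub>R y)"
        using * inverse_plus_scalar_apply by auto
    qed
    finally show ?thesis .
  qed
  then have "adjoint_operator ?S y = ?S y" for y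
    by (metis not_None_eq)
  with lin dd show ?thesis
    by (auto simp: self_adjoint_def)
qed

end

text \<open>The resolvent maps the unit ball into the image under \<open>B\<close> of the ball of
  radius \<open>1 + \<bar>r\<bar>\<close>: for \<open>x = B v\<close> one has
  \<open>v = the (S x) - r *\<^sub>R x\<close>, and the norm identity bounds both terms. Compactness
  of \<open>B\<close> then suffices.\<close>

lemma compact_resolvent_inverse_plus_scalar:
  fixes B :: "'h::complex_hilbert \<Rightarrow> 'h"
  assumes B: "clinear_on UNIV B" and sym: "\<And>x y. inner (B x) y = inner x (B y)"
    and dense: "closure (range B) = UNIV" and cpt: "compact_map B"
  shows "compact_resolvent (inverse_plus_scalar B r)"
proof -
  define S where "S = inverse_plus_scalar B r"
  have sa: "self_adjoint S"
    unfolding S_def using B sym dense by (rule self_adjoint_inverse_plus_scalar)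
  have "\<exists>l s. strict_mono s \<and> (\<lambda>n. y (s n)) \<longlonglongrightarrow> l"
    if y: "\<And>n::nat. y n \<in> resolvent S \<i> ` {x. norm x \<le> 1}" for y
  proof -
    have "\<exists>v. y n = B v \<and> norm v \<le> 1 + \<bar>r\<bar>" for n
    proof -
      obtain f where f: "norm f \<le> 1" "y n = resolvent S \<i> f"
        using y[of n] by blast
      obtain x where x: "x \<in> dom S" "f = the (S x) - \<i> *\<^sub>C x"
        using self_adjoint_bij_betw_shift[OF sa] unfolding bij_betw_def by blast
      have yx: "y n = x"
        using f(2) resolvent_eqI[OF sa x(1)] x(2) by simp
      obtain v where v: "x = B v"
        using x(1) unfolding S_def dom_inverse_plus_scalar by blast
      have le: "norm x \<le> norm f" "norm (the (S x)) \<le> norm f"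
        unfolding x(2)
        by (auto simp: self_adjoint_norm_shift[OF sa x(1)] intro: power2_le_imp_le[OF _ norm_ge_zero])
      have "v = the (S x) - r *\<^sub>R x"
        by (simp add: S_def v inverse_plus_scalar_apply[OF B sym dense])
      then have "norm v \<le> norm (the (S x)) + \<bar>r\<bar> * norm x"
        using norm_triangle_ineq4[of "the (S x)" "r *\<^sub>R x"] by simp
      also have "\<dots> \<le> 1 + \<bar>r\<bar> * 1"
        using le f(1) by (intro add_mono mult_left_mono) auto
      finally show ?thesis
        using yx v by auto
    qed
    then obtain v where v: "\<And>n. y n = B (v n)" "\<And>n. norm (v n) \<le> 1 + \<bar>r\<bar>"
      by metis
    have "bounded (range v)"
      using v(2) by (auto intro: boundedI)
    then show ?thesis
      using cpt unfolding compact_map_def v(1) by blast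
  qed
  then have "compact (closure (resolvent S \<i> ` {x. norm x \<le> 1}))"
    by (rule compact_closure_if_convergent_subsequences)
  then have "compact_resolvent S"
    using clinear_on_resolvent[OF sa] self_adjoint_bij_betw_minus_scalar[OF sa]
    by (simp add: compact_resolvent_def compact_linear_on_def)
  then show ?thesis by (simp add: S_def)
qed

text \<open>Adjoints reverse inclusion: the condition defining the adjoint of \<open>S\<close>
  restricts to the smaller domain of \<open>T\<close>, so \<open>S\<close>, being its own adjoint,
  lies in the adjoint of \<open>T\<close>.\<close>

lemma self_adjoint_extension_if_symmetric:
  fixes S T :: "'h::complex_hilbert \<rightharpoonup> 'h"
  assumes T: "linear_operator T" "densely_defined T" and S: "self_adjoint S" and TS: "T \<subseteq>\<^sub>m S"
  shows "self_adjoint_extension T S"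
proof -
  have "adjoint_operator T y = S y" if y: "y \<in> dom S" for y
  proof -
    obtain z where z: "S y = Some z" using y by blast
    have "inner (the (T x)) y = inner x z" if x: "x \<in> dom T" for x
    proof -
      have "S x = T x" "x \<in> dom S"
        using x TS by (auto simp: map_le_def) (metis domI)
      then show ?thesis
        using self_adjoint_inner[OF S _ y, of x] z by simp
    qed
    then show ?thesis
      using z by (simp add: adjoint_operator_eq_Some_iff[OF T])
  qed
  then show ?thesis
    using S TS by (simp add: self_adjoint_extension_def map_le_def)
qed

section \<open>From a compact embedding to an extension with compact resolvent\<close>

lemma exists_self_adjoint_extension_compact_resolvent:
  fixes T :: "'h::complex_hilbert \<rightharpoonup> 'h"
  assumes T: "linear_operator T" "densely_defined T" "closed_operator T" "symmetric_operator T"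
    and emb: "domain_compactly_embedded T"
  shows "\<exists>S. self_adjoint_extension T S \<and> compact_resolvent S"
proof -
  define D where "D = dom T"
  note lin = T(1)
  obtain r :: real where r: "\<And>x. x \<in> D \<Longrightarrow> the (T x) = r *\<^sub>R x \<Longrightarrow> x = 0"
    using exists_real_non_eigenvalue[OF lin emb T(4)] unfolding D_def by blast
  obtain c where c: "c > 0" "\<And>x. x \<in> D \<Longrightarrow> c * norm x \<le> norm (the (T x) - r *\<^sub>R x)"
    using bounded_below_if_non_eigenvalue[OF lin emb T(3) r[unfolded D_def]] unfolding D_def by blast
  define A where "A x = the (T x) - r *\<^sub>R x" for x
  note c_le = c(2)[folded A_def]
  have A: "clinear_on D A"
    using clinear_on_shift[OF lin, of "of_real r"]
    unfolding scaleC_of_real A_def[symmetric] D_def[symmetric] .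
  have D: "complex_vector.subspace D" "subspace D"
    using linear_operator_csubspace_dom[OF lin] linear_operator_subspace_dom[OF lin]
    by (simp_all add: D_def)
  have A_add: "A (x + y) = A x + A y" if "x \<in> D" "y \<in> D" for x y
    using A that by (simp add: clinear_on_def)
  have A_scaleC: "A (a *\<^sub>C x) = a *\<^sub>C A x" if "x \<in> D" for a x
    using A that by (simp add: clinear_on_def)
  have A_diff: "A (x - y) = A x - A y" if "x \<in> D" "y \<in> D" for x y
    using that by (simp add: A_def D_def linear_operator_diff[OF lin] scaleR_right_diff_distrib)
  have inj: "inj_on A D"
  proof (rule inj_onI)
    fix x y assume xy: "x \<in> D" "y \<in> D" "A x = A y"
    then have "c * norm (x - y) \<le> 0"
      using c_le[OF subspace_diff[OF D(2) xy(1,2)]] A_diff[OF xy(1,2)] by simp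
    then show "x = y"
      using c(1) by (simp add: mult_le_0_iff)
  qed
  define M where "M = A ` D"
  have M: "complex_vector.subspace M"
    unfolding M_def using csubspace_clinear_image[OF A] .
  \<comment> \<open>The lower bound makes preimages of a convergent sequence Cauchy, and closedness
    of \<open>T\<close> identifies the image of their limit.\<close>
  have closed: "closed M"
    unfolding closed_sequential_limits
  proof (intro allI impI, elim conjE)
    fix y l assume y: "\<forall>n. y n \<in> M" and l: "y \<longlonglongrightarrow> l"
    from y have "\<forall>n. \<exists>x. x \<in> D \<and> y n = A x"
      unfolding M_def by blast
    then obtain x where x: "\<And>n. x n \<in> D" "\<And>n. y n = A (x n)"
      by metis
    have "Cauchy x"
    proof (rule metric_CauchyI)
      fix e :: real assume "e > 0"
      then obtain N where N: "\<And>m n. m \<ge> N \<Longrightarrow> n \<ge> N \<Longrightarrow> dist (y m) (y n) < c * e"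
        using metric_CauchyD[OF LIMSEQ_imp_Cauchy[OF l], of "c * e"] c(1) by auto
      have "dist (x m) (x n) < e" if mn: "m \<ge> N" "n \<ge> N" for m n
      proof -
        have "c * dist (x m) (x n) \<le> dist (y m) (y n)"
          using c_le[OF subspace_diff[OF D(2) x(1)[of m] x(1)[of n]]] x
          by (simp add: dist_norm A_diff)
        also have "\<dots> < c * e" using N[OF mn] .
        finally show ?thesis using c(1) by simp
      qed
      then show "\<exists>N. \<forall>m\<ge>N. \<forall>n\<ge>N. dist (x m) (x n) < e" by blast
    qed
    then obtain p where p: "x \<longlonglongrightarrow> p"
      by (auto simp: Cauchy_convergent_iff convergent_def)
    have "(\<lambda>n. A (x n) + r *\<^sub>R x n) \<longlonglongrightarrow> l + r *\<^sub>R p"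
      unfolding x(2)[symmetric] by (intro tendsto_intros p l)
    then have Tp: "(\<lambda>n. the (T (x n))) \<longlonglongrightarrow> l + r *\<^sub>R p"
      by (simp add: A_def)
    have "(x n, the (T (x n))) \<in> Map.graph T" for n
      using x(1)[of n] by (auto simp: Map.graph_def D_def)
    then have "(p, l + r *\<^sub>R p) \<in> Map.graph T"
      using closed_sequentially[OF T(3)[unfolded closed_operator_def] _ tendsto_Pair[OF p Tp]] by blast
    then have "p \<in> D" "A p = l"
      by (auto simp: Map.graph_def D_def A_def)
    then show "l \<in> M"
      by (auto simp: M_def)
  qed
  note M' = complex_subspace_imp_subspace[OF M] closed
  define P where "P = orthogonal_projection M"
  have P: "bounded_linear P" "\<And>x. P x \<in> M" "\<And>x. x \<in> M \<Longrightarrow> P x = x"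
      "\<And>x m. m \<in> M \<Longrightarrow> inner (x - P x) m = 0" "\<And>a x. P (a *\<^sub>C x) = a *\<^sub>C P x"
    unfolding P_def
    by (rule bounded_linear_orthogonal_projection[OF M'] orthogonal_projection_mem[OF M']
        orthogonal_projection_ident[OF M'] orthogonal_projection_orthogonal[OF M']
        orthogonal_projection_scaleC[OF M closed]; assumption?)+
  interpret P: bounded_linear P by fact
  have P_le: "norm (P x) \<le> norm x" for x
    unfolding P_def by (rule norm_orthogonal_projection_le[OF M'])
  \<comment> \<open>\<open>C\<close> inverts \<open>A\<close> on \<open>M\<close> and vanishes on
    the orthogonal complement, so it is defined everywhere. Identities for \<open>C\<close> are then
    checked after applying \<open>A\<close>, which is injective on \<open>D\<close>.\<close>
  define C where "C f = the_inv_into D A (P f)" for f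
  have C_mem: "C f \<in> D" and A_C: "A (C f) = P f" for f
    using the_inv_into_into[OF inj, of "P f" D] f_the_inv_into_f[OF inj, of "P f"] P(2)[of f]
    by (auto simp: C_def M_def)
  have C_eqI: "C f = x" if "x \<in> D" "A x = P f" for f x
    using inj_onD[OF inj] that C_mem A_C by metis
  have C_scaleC: "C (a *\<^sub>C f) = a *\<^sub>C C f" for a f
    by (rule C_eqI) (simp_all add: complex_vector.subspace_scale[OF D(1)] C_mem A_scaleC A_C P)
  have C_le: "c * norm (C f) \<le> norm f" for f
    using c_le[OF C_mem, of f] P_le[of f] by (simp add: A_C)
  have C: "bounded_linear C"
  proof (rule bounded_linear_intro[where K = "inverse c"])
    show "C (f + g) = C f + C g" for f g
      by (rule C_eqI) (simp_all add: subspace_add[OF D(2)] C_mem A_add A_C P.add)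
    show "C (a *\<^sub>R f) = a *\<^sub>R C f" for a f
      using C_scaleC[of "of_real a" f] by (simp add: scaleC_of_real)
    show "norm (C f) \<le> norm f * inverse c" for f
      using C_le[of f] c(1) by (simp add: field_simps)
  qed
  have C_cpt: "compact_map C"
    unfolding compact_map_def
  proof (intro allI impI)
    fix f :: "nat \<Rightarrow> 'h" assume "bounded (range f)"
    then obtain K where K: "\<And>n. norm (f n) \<le> K"
      by (auto simp: bounded_iff)
    have x_le: "norm (C (f n)) \<le> K / c" for n
      using C_le[of "f n"] K[of n] c(1) by (simp add: field_simps)
    have "norm (the (T (C (f n)))) \<le> K + \<bar>r\<bar> * (K / c)" for n
    proof -
      have "norm (the (T (C (f n)))) \<le> norm (A (C (f n))) + norm (r *\<^sub>R C (f n))"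
        using norm_triangle_ineq[of "A (C (f n))" "r *\<^sub>R C (f n)"] by (simp add: A_def)
      also have "\<dots> \<le> K + \<bar>r\<bar> * (K / c)"
        unfolding A_C norm_scaleR using P_le[of "f n"] K[of n] x_le[of n]
        by (intro add_mono mult_left_mono) auto
      finally show ?thesis .
    qed
    \<comment> \<open>\<open>compactly_embedded_subsequence\<close> takes one bound for both norms,
      hence the maximum of the two estimates.\<close>
    then have Tx_le: "norm (the (T (C (f n)))) \<le> max (K / c) (K + \<bar>r\<bar> * (K / c))" for n
      by (simp add: le_max_iff_disj)
    have "norm (C (f n)) \<le> max (K / c) (K + \<bar>r\<bar> * (K / c))" for n
      using x_le[of n] by (simp add: le_max_iff_disj)
    then obtain l s where "strict_mono s" "(\<lambda>n. C (f (s n))) \<longlonglongrightarrow> l"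
      by (rule compactly_embedded_subsequence[where x = "\<lambda>n. C (f n)",
            OF lin emb C_mem[unfolded D_def] _ Tx_le])
    then show "\<exists>l s. strict_mono s \<and> (\<lambda>n. C (f (s n))) \<longlonglongrightarrow> l"
      by blast
  qed
  \<comment> \<open>\<open>T - r\<close> is symmetric because \<open>r\<close> is real. Transported
    to \<open>M\<close>, this says that \<open>C\<close> followed by \<open>P\<close> is symmetric,
    so the diagonal block of \<open>C\<close> on \<open>M\<close> is symmetric.\<close>
  have C_sym: "inner (C f) (P g) = inner (P f) (C g)" for f g
  proof -
    have "inner (the (T (C f))) (C g) = inner (C f) (the (T (C g)))"
      using T(4) C_mem by (simp add: symmetric_operator_def inner_eq_Re_cinner D_def)
    then have "inner (C f) (A (C g)) = inner (A (C f)) (C g)"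
      by (simp add: A_def inner_diff_left inner_diff_right)
    then show ?thesis by (simp add: A_C)
  qed
  \<comment> \<open>In block form with respect to \<open>M\<close> and its orthogonal complement, \<open>C\<close> is the first column of
    \<open>B\<close>, its adjoint supplies the upper right block, and the lower right block is 0.\<close>
  define B where "B f = C f + adjoint C (f - P f)" for f
  note adj = adjoint_works_bounded_linear[OF C]
  interpret C: bounded_linear C by fact
  interpret adj: bounded_linear "adjoint C"
    by (rule bounded_linear_adjoint[OF C])
  have "clinear_on UNIV B"
    unfolding clinear_on_def
    by (simp add: B_def C.add C_scaleC P.add P(5) adj.add adj.diff adjoint_scaleC[OF C C_scaleC]
        scaleC_add_right complex_vector.scale_right_diff_distrib)
  \<comment> \<open>Splitting \<open>g\<close> into \<open>P g\<close> and \<open>g - P g\<close>,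
    the block on \<open>M\<close> is handled by \<open>C_sym\<close>, and the two off-diagonal terms
    are exchanged because they are adjoint to each other.\<close>
  moreover have "inner (B f) g = inner f (B g)" for f g
    using C_sym[of f g] adj[of g "f - P f"] adj[of f "g - P g"]
    by (simp add: B_def inner_add_left inner_add_right inner_diff_left inner_diff_right
        inner_commute)
  \<comment> \<open>On \<open>M\<close> the projection is the identity, so the adjoint term drops
    out and \<open>B\<close> agrees there with the inverse of \<open>A\<close>.\<close>
  moreover have B_A: "B (A x) = x" if "x \<in> D" for x
  proof -
    have "P (A x) = A x"
      using that by (intro P) (simp add: M_def)
    then show ?thesis
      using that by (simp add: B_def adj.zero C_eqI)
  qed
  have "closure (range B) = UNIV"
  proof -
    have "D \<subseteq> range B"
      using B_A by (metis rangeI subsetI)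
    then show ?thesis
      using closure_mono[of D "range B"] T(2) by (auto simp: densely_defined_def D_def)
  qed
  moreover have "compact_map B"
    unfolding B_def
    by (intro compact_map_add C_cpt compact_map_adjoint C
        compact_map_compose_bounded_linear[of "adjoint C" "\<lambda>f. f - P f"]
        bounded_linear_sub bounded_linear_ident P(1))
  ultimately have B: "clinear_on UNIV B" "\<And>f g. inner (B f) g = inner f (B g)"
    "closure (range B) = UNIV" "compact_map B" by blast+
  define S where "S = inverse_plus_scalar B r"
  \<comment> \<open>At \<open>x = B (A x)\<close> the operator \<open>S\<close> takes the value
    \<open>A x + r *\<^sub>R x\<close>, which undoes the shift by \<open>r\<close> in
    \<open>A\<close>.\<close>
  have "T x = S x" if x: "x \<in> dom T" for x
  proof -
    have "S (B (A x)) = Some (A x + r *\<^sub>R B (A x))"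
      unfolding S_def by (rule inverse_plus_scalar_apply[OF B(1,2,3)])
    then show ?thesis
      using x B_A[of x] by (auto simp: A_def D_def)
  qed
  then have "T \<subseteq>\<^sub>m S"
    by (simp add: map_le_def)
  moreover have "self_adjoint S"
    unfolding S_def by (rule self_adjoint_inverse_plus_scalar[OF B(1,2,3)])
  ultimately have "self_adjoint_extension T S"
    using T by (intro self_adjoint_extension_if_symmetric)
  moreover have "compact_resolvent S"
    unfolding S_def by (rule compact_resolvent_inverse_plus_scalar[OF B])
  ultimately show ?thesis by blast
qed

theorem theorem1p1:
  fixes T :: "'h::complex_hilbert \<rightharpoonup> 'h"
  assumes "separable_space (euclidean :: 'h topology)"
    and "linear_operator T"
    and "densely_defined T"
    and "closed_operator T"
    and "symmetric_operator T"
    and "cdim (operator_kernel (minus_scalar (adjoint_operator T) \<i>)) =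
         cdim (operator_kernel (minus_scalar (adjoint_operator T) (- \<i>)))"
  shows "(\<exists>S. self_adjoint_extension T S \<and> compact_resolvent S) \<longleftrightarrow>
         domain_compactly_embedded T"
  using domain_compactly_embedded_if_compact_resolvent[OF assms(2)]
    exists_self_adjoint_extension_compact_resolvent[OF assms(2-5)]
  by blast

end
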